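(* Let $n\ge 1$ and let $R_n(x)=\sum_{k=0}^{n-1} c_n(k)x^k$. Then: (i) the number of nonzero coefficients of $R_n(x)$ is $\gamma(n)$; (ii) the degree of $R_n(x)$ is $n-n/\gamma(n)$; (iii) $R_n(x)$ has (at least one) coefficient equal to $\pm 1$ if and only if $n$ is squarefree, and in this case the number of coefficients of $R_n(x)$ equal to $\pm 1$ is $\varphi(n)$ if $n$ is odd and $2\varphi(n/2)$ if $n$ is even.
   Context: For integers $n\ge 1$ and $k$, the Ramanujan sum is $c_n(k)=\sum_{1\le j\le n,\ \gcd(j,n)=1} e^{2\pi i jk/n}$ (an integer). $\gamma(n)=\prod_{p\mid n} p$ denotes the squarefree kernel of $n$ (product of the distinct primes dividing $n$, with $\gamma(1)=1$), and $\varphi$ is Euler's totient function. *)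

theory Defs
  imports Complex_Main
    "HOL-Computational_Algebra.Polynomial"
    "HOL-Computational_Algebra.Squarefree"
    "HOL-Number_Theory.Totient"
begin

definition ramanujan_sum :: "nat \<Rightarrow> int \<Rightarrow> complex" where
  "ramanujan_sum n k =
     (\<Sum>j | 1 \<le> j \<and> j \<le> n \<and> coprime j n.
        exp (2 * of_real pi * \<i> * of_nat j * of_int k / of_nat n))"

definition squarefree_kernel :: "nat \<Rightarrow> nat" where
  "squarefree_kernel n = (\<Prod>p\<in>prime_factors n. p)"

lemma squarefree_kernel_dvd:
  assumes "n \<ge> 1"
  shows "squarefree_kernel n dvd n"
proof -
  have "squarefree_kernel n dvd (\<Prod>p\<in>prime_factors n. p ^ multiplicity p n)"
    unfolding squarefree_kernel_def
    by (intro prod_dvd_prod dvd_power) (auto simp: prime_factors_multiplicity)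
  also have "\<dots> = n"
    using assms by (simp add: prime_factorization_nat[symmetric])
  finally show ?thesis .
qed

definition ramanujan_poly :: "nat \<Rightarrow> complex poly" where
  "ramanujan_poly n = (\<Sum>k<n. monom (ramanujan_sum n (int k)) k)"

end

theory Submission
  imports Defs "HOL-Analysis.Complex_Transcendental"
begin

text \<open>
  Write \<open>n = \<gamma>(n) m\<close>. Coprimality to \<open>n\<close> depends only on residues modulo \<open>\<gamma>(n)\<close>, so summing over
  the \<open>m\<close> lifts of each residue gives \<open>c\<^sub>n(k) = 0\<close> unless \<open>m\<close> divides \<open>k\<close>, and
  \<open>c\<^sub>n(m l) = m c\<^bsub>\<gamma>(n)\<^esub>(l)\<close>. For a squarefree modulus, removing one prime \<open>p\<close> at a time yields
  \<open>c\<^sub>n(k)\<close> as the product over \<open>p | n\<close> of \<open>p - 1\<close> (if \<open>p | k\<close>) or \<open>-1\<close> (otherwise). This is never zero,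
  and has absolute value 1 iff 2 is the only prime that can divide both \<open>n\<close> and \<open>k\<close>.
\<close>

section \<open>Additive characters and their orthogonality\<close>

definition additive_char :: "nat \<Rightarrow> nat \<Rightarrow> complex" where
  "additive_char n j = exp (2 * of_real pi * \<i> * of_nat j / of_nat n)"

lemma additive_char_add: "additive_char n (i + j) = additive_char n i * additive_char n j"
  by (simp add: additive_char_def exp_add [symmetric] add_divide_distrib ring_distribs)

lemma additive_char_power: "additive_char n j ^ i = additive_char n (j * i)"
  by (simp add: additive_char_def exp_of_nat_mult [symmetric] field_simps)

lemma additive_char_mult_cancel:
  "d > 0 \<Longrightarrow> additive_char (d * n) (d * j) = additive_char n j"
  by (simp add: additive_char_def field_simps)

lemma additive_char_eq_1_iff:
  assumes "n \<ge> 1"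
  shows "additive_char n j = 1 \<longleftrightarrow> n dvd j"
  using complex_root_unity_eq_1 [OF assms, of j] by (simp add: additive_char_def)

text \<open>If \<open>d\<close> divides \<open>k\<close>, every term is 1. Otherwise this is a full
  geometric sum whose ratio is a \<open>d\<close>-th root of unity different from 1.\<close>

lemma sum_additive_char:
  assumes "d \<ge> 1"
  shows "(\<Sum>b<d. additive_char d (k * b)) = (if d dvd k then of_nat d else 0)"
proof (cases "d dvd k")
  case True
  then have "additive_char d (k * b) = 1" for b
    using assms by (simp add: additive_char_eq_1_iff)
  then show ?thesis using True by simp
next
  case False
  then have "additive_char d k \<noteq> 1"
    using assms by (simp add: additive_char_eq_1_iff)
  moreover have "additive_char d k ^ d = 1"
    using assms by (simp add: additive_char_power additive_char_eq_1_iff)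
  ultimately have "(\<Sum>b<d. additive_char d k ^ b) = 0"
    by (simp add: geometric_sum)
  then show ?thesis using False by (simp add: additive_char_power)
qed

section \<open>Ramanujan sums as character sums over coprime residues\<close>

lemma coprime_lessThan_eq_atMost:
  assumes "n > (1::nat)"
  shows "{j. j < n \<and> coprime j n} = {j. 1 \<le> j \<and> j \<le> n \<and> coprime j n}"
proof -
  have "j \<noteq> 0 \<and> j \<noteq> n" if "coprime j n" for j
    using that assms by (cases "j = 0") auto
  then show ?thesis by (auto simp: Suc_le_eq intro: le_neq_implies_less)
qed

lemma ramanujan_sum_eq:
  assumes "n \<ge> 1"
  shows "ramanujan_sum n (int k) = (\<Sum>j | j < n \<and> coprime j n. additive_char n (j * k))"
proof (cases "n = 1")
  case True
  \<comment> \<open>Only for \<open>n = 1\<close> do the two index ranges differ; both single terms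
    equal 1 because the character modulo 1 is trivial.\<close>
  have "{j. 1 \<le> j \<and> j \<le> n \<and> coprime j n} = {1}" "{j. j < n \<and> coprime j n} = {0}"
    using True by auto
  moreover have "additive_char 1 k = 1" "additive_char 1 0 = 1"
    by (simp_all add: additive_char_eq_1_iff)
  ultimately show ?thesis using True
    by (simp add: ramanujan_sum_def additive_char_def)
next
  case False
  then show ?thesis using assms
    by (simp add: ramanujan_sum_def additive_char_def coprime_lessThan_eq_atMost mult.assoc)
qed

lemma ramanujan_sum_0: "ramanujan_sum n 0 = of_nat (totient n)"
proof -
  have "{j. 1 \<le> j \<and> j \<le> n \<and> coprime j n} = totatives n"
    by (auto simp: totatives_def)
  then show ?thesis by (simp add: ramanujan_sum_def totient_def)
qed

section \<open>Lifting residues to a larger modulus\<close>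

text \<open>Each \<open>j < q * d\<close> is uniquely \<open>a + q * b\<close> with
  \<open>a < q\<close> and \<open>b < d\<close>, and its coprimality to \<open>q\<close> depends
  only on \<open>a\<close>. The sum over \<open>b\<close> is a full character sum modulo
  \<open>d\<close>, so orthogonality decides between \<open>d\<close> and 0.\<close>

lemma sum_lifted_coprime_residues:
  assumes "q \<ge> 1" "d \<ge> 1"
  shows "(\<Sum>j | j < q * d \<and> coprime j q. additive_char (q * d) (j * k)) =
    (if d dvd k then of_nat d * ramanujan_sum q (int (k div d)) else 0)"
proof -
  define A where "A = {a. a < q \<and> coprime a q}"
  have "(\<Sum>j | j < q * d \<and> coprime j q. additive_char (q * d) (j * k)) =
      (\<Sum>(a, b)\<in>A \<times> {..<d}. additive_char (q * d) ((a + q * b) * k))"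
  proof (rule sum.reindex_bij_witness
      [where i = "\<lambda>(a, b). a + q * b" and j = "\<lambda>j. (j mod q, j div q)"])
    fix j assume j: "j \<in> {j. j < q * d \<and> coprime j q}"
    show "(case (j mod q, j div q) of (a, b) \<Rightarrow> a + q * b) = j" by simp
    show "(j mod q, j div q) \<in> A \<times> {..<d}"
      using j assms by (auto simp: A_def less_mult_imp_div_less mult.commute)
    show "(case (j mod q, j div q) of (a, b) \<Rightarrow> additive_char (q * d) ((a + q * b) * k)) =
        additive_char (q * d) (j * k)" by simp
  next
    fix x assume "x \<in> A \<times> {..<d}"
    then obtain a b where x: "x = (a, b)" "a < q" "coprime a q" "b < d"
      by (auto simp: A_def)
    show "((case x of (a, b) \<Rightarrow> a + q * b) mod q, (case x of (a, b) \<Rightarrow> a + q * b) div q) = x"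
      using x by simp
    have "a + q * b < q * (b + 1)" using x by simp
    also have "\<dots> \<le> q * d" using x by (intro mult_le_mono2) simp
    finally have "a + q * b < q * d" .
    moreover have "coprime (a + q * b) q"
      using x by (metis coprime_mod_left_iff mod_mult_self2 gr_implies_not0)
    ultimately show "(case x of (a, b) \<Rightarrow> a + q * b) \<in> {j. j < q * d \<and> coprime j q}"
      using x by simp
  qed
  also have "\<dots> = (\<Sum>a\<in>A. \<Sum>b<d. additive_char (q * d) ((a + q * b) * k))"
    by (simp add: sum.cartesian_product)
  also have "\<dots> = (\<Sum>a\<in>A. additive_char (q * d) (a * k) * (\<Sum>b<d. additive_char d (k * b)))"
  proof (intro sum.cong refl)
    fix a assume "a \<in> A"
    have "additive_char (q * d) ((a + q * b) * k) =
        additive_char (q * d) (a * k) * additive_char d (k * b)" for b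
    proof -
      have "(a + q * b) * k = a * k + q * (k * b)" by (simp add: algebra_simps)
      then show ?thesis
        using assms additive_char_mult_cancel [of q d "k * b"] by (simp add: additive_char_add)
    qed
    then show "(\<Sum>b<d. additive_char (q * d) ((a + q * b) * k)) =
        additive_char (q * d) (a * k) * (\<Sum>b<d. additive_char d (k * b))"
      by (simp add: sum_distrib_left)
  qed
  also have "\<dots> = (if d dvd k then of_nat d * ramanujan_sum q (int (k div d)) else 0)"
  proof (cases "d dvd k")
    case True
    then obtain l where l: "k = d * l" by blast
    have "additive_char (q * d) (a * k) = additive_char q (a * l)" for a
      using additive_char_mult_cancel [of d q "a * l"] assms l by (simp add: ac_simps)
    then have "(\<Sum>a\<in>A. additive_char (q * d) (a * k)) = ramanujan_sum q (int l)"
      using assms by (simp add: ramanujan_sum_eq A_def)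
    then show ?thesis
      using assms l by (simp add: sum_additive_char sum_distrib_right [symmetric])
  next
    case False
    then show ?thesis using assms by (simp add: sum_additive_char)
  qed
  finally show ?thesis .
qed

text \<open>At \<open>k = 0\<close> every character value is 1, so the lifted sum counts its index
  set.\<close>

lemma card_lifted_coprime_residues:
  assumes "q \<ge> 1" "d \<ge> 1"
  shows "card {j. j < q * d \<and> coprime j q} = d * totient q"
proof -
  have "additive_char (q * d) 0 = 1" by (simp add: additive_char_def)
  then have "of_nat (card {j. j < q * d \<and> coprime j q}) = (of_nat (d * totient q) :: complex)"
    using sum_lifted_coprime_residues [OF assms, of 0] by (simp add: ramanujan_sum_0)
  then show ?thesis by (simp only: of_nat_eq_iff)
qed

section \<open>Squarefree moduli\<close>

text \<open>Being coprime to \<open>p * q\<close> means being coprime to \<open>q\<close> and not a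
  multiple of \<open>p\<close>. The sum over \<open>U\<close> comes from lifting by
  \<open>d = p\<close>; the multiples of \<open>p\<close>, collected in \<open>V\<close>, account
  for the subtracted term.\<close>

lemma ramanujan_sum_prime_mult:
  assumes "q \<ge> 1" "prime p" "coprime p q"
  shows "ramanujan_sum (p * q) (int k) =
    (if p dvd k then of_nat p * ramanujan_sum q (int (k div p)) else 0) - ramanujan_sum q (int k)"
proof -
  have p: "p > 0" using assms prime_gt_0_nat by blast
  define U where "U = {j. j < q * p \<and> coprime j q}"
  define V where "V = {j. j < q * p \<and> coprime j q \<and> p dvd j}"
  have "coprime j p \<longleftrightarrow> \<not> p dvd j" for j
    using assms by (metis coprime_commute prime_imp_coprime coprime_absorb_left not_prime_unit)
  then have diff: "{j. j < p * q \<and> coprime j (p * q)} = U - V"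
    by (auto simp: U_def V_def mult.commute)
  \<comment> \<open>As \<open>p\<close> is coprime to \<open>q\<close>, the elements of
    \<open>V\<close> are the \<open>p * j\<close> with \<open>j < q\<close> coprime to
    \<open>q\<close>; the factor \<open>p\<close> cancels in the character.\<close>
  have "(\<Sum>j\<in>V. additive_char (q * p) (j * k)) =
      (\<Sum>j | j < q \<and> coprime j q. additive_char q (j * k))"
  proof (rule sum.reindex_bij_witness [where i = "\<lambda>j. p * j" and j = "\<lambda>j. j div p"])
    fix j assume "j \<in> V"
    then obtain i where i: "j = p * i" "p * i < q * p" "coprime (p * i) q"
      by (auto simp: V_def)
    then show "p * (j div p) = j" "j div p \<in> {j. j < q \<and> coprime j q}"
      using p by (auto simp: mult.commute)
    show "additive_char q (j div p * k) = additive_char (q * p) (j * k)"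
      using i p additive_char_mult_cancel [of p q "i * k"] by (simp add: ac_simps)
  next
    fix j assume "j \<in> {j. j < q \<and> coprime j q}"
    then show "p * j div p = j" "p * j \<in> V"
      using p assms by (auto simp: V_def mult.commute)
  qed
  then have V: "(\<Sum>j\<in>V. additive_char (q * p) (j * k)) = ramanujan_sum q (int k)"
    using assms by (simp add: ramanujan_sum_eq)
  have "ramanujan_sum (p * q) (int k) = (\<Sum>j\<in>U - V. additive_char (q * p) (j * k))"
    using assms p ramanujan_sum_eq [of "p * q" k] unfolding diff by (simp add: mult.commute)
  also have "\<dots> = (\<Sum>j\<in>U. additive_char (q * p) (j * k)) - (\<Sum>j\<in>V. additive_char (q * p) (j * k))"
    by (rule sum_diff) (auto simp: U_def V_def)
  also have "(\<Sum>j\<in>U. additive_char (q * p) (j * k)) =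
      (if p dvd k then of_nat p * ramanujan_sum q (int (k div p)) else 0)"
    using sum_lifted_coprime_residues [of q p k] assms p by (simp add: U_def)
  finally show ?thesis using V by simp
qed

text \<open>Induction on \<open>A\<close>, with \<open>k\<close> arbitrary because the recursion for
  a new prime \<open>p\<close> also evaluates the smaller sum at \<open>k div p\<close>. Dividing by
  \<open>p\<close> does not affect divisibility by the other primes, so both values agree and the
  new factor is \<open>p - 1\<close> or \<open>-1\<close>.\<close>

lemma ramanujan_sum_prod_primes:
  assumes "finite A" "\<And>p. p \<in> A \<Longrightarrow> prime p"
  shows "ramanujan_sum (\<Prod>A) (int k) =
    of_int (\<Prod>p\<in>A. if p dvd k then int p - 1 else -1)"
  using assms
proof (induction A arbitrary: k rule: finite_induct)
  case empty
  have "additive_char 1 0 = 1" by (simp add: additive_char_def)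
  moreover have "{j. j < (1::nat) \<and> coprime j 1} = {0}" by auto
  ultimately show ?case by (simp add: ramanujan_sum_eq)
next
  case (insert p A)
  have p: "prime p" and A: "\<And>r. r \<in> A \<Longrightarrow> prime r" using insert.prems by auto
  have IH: "ramanujan_sum (\<Prod>A) (int l) = of_int (\<Prod>r\<in>A. if r dvd l then int r - 1 else -1)" for l
    using insert.IH A by blast
  have cop: "coprime p (\<Prod>A)"
    using insert.hyps p A by (intro prod_coprime_right) (metis primes_coprime)
  have pos: "\<Prod>A \<ge> 1"
    using A by (simp add: Suc_le_eq prod_pos prime_gt_0_nat)
  have dvd: "r dvd k div p \<longleftrightarrow> r dvd k" if pk: "p dvd k" and r: "r \<in> A" for r
  proof -
    obtain l where l: "k = p * l" using pk ..
    have "coprime r p" using r A p insert.hyps by (metis primes_coprime)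
    then show ?thesis using l p prime_gt_0_nat [OF p] by (simp add: coprime_dvd_mult_right_iff)
  qed
  have "ramanujan_sum (\<Prod>A) (int (k div p)) = ramanujan_sum (\<Prod>A) (int k)" if "p dvd k"
    unfolding IH by (intro arg_cong [where f = of_int] prod.cong) (simp_all add: dvd that)
  then have "ramanujan_sum (p * \<Prod>A) (int k) =
      (if p dvd k then of_nat p - 1 else -1) * ramanujan_sum (\<Prod>A) (int k)"
    by (simp add: ramanujan_sum_prime_mult [OF pos p cop] algebra_simps)
  then show ?case
    using insert.hyps by (simp add: IH)
qed

section \<open>Reduction to the squarefree kernel\<close>

lemma squarefree_kernel_pos: "squarefree_kernel n \<ge> 1"
  by (simp add: squarefree_kernel_def Suc_le_eq prod_pos prime_factors_gt_0_nat)

text \<open>Both numbers have the same prime divisors. This lets the lifting lemma, taken at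
  \<open>q = squarefree_kernel n\<close>, describe the sum for \<open>n\<close> itself.\<close>

lemma coprime_squarefree_kernel_iff:
  assumes "n \<ge> 1"
  shows "coprime j (squarefree_kernel n) \<longleftrightarrow> coprime j n"
proof
  assume cop: "coprime j (squarefree_kernel n)"
  show "coprime j n"
  proof (rule ccontr)
    assume "\<not> coprime j n"
    then obtain p where p: "prime p" "p dvd j" "p dvd n"
      using assms by (metis coprime_iff_gcd_eq_1 gcd_greatest_iff prime_factor_nat)
    then have "p dvd squarefree_kernel n"
      unfolding squarefree_kernel_def using assms
      by (intro dvd_prodI) (auto simp: prime_factors_dvd)
    then show False using p cop by (metis coprime_common_divisor not_prime_unit)
  qed
next
  assume "coprime j n"
  then show "coprime j (squarefree_kernel n)"
    using coprime_divisors [OF dvd_refl squarefree_kernel_dvd [OF assms]] by blast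
qed

lemma squarefree_iff_squarefree_kernel_eq:
  assumes "n \<ge> 1"
  shows "squarefree n \<longleftrightarrow> squarefree_kernel n = n"
proof
  assume "squarefree n"
  then have "multiplicity p n = 1" if "p \<in> prime_factors n" for p
    using that assms by (auto simp: squarefree_factorial_semiring' prime_factors_dvd)
  then have "squarefree_kernel n = (\<Prod>p\<in>prime_factors n. p ^ multiplicity p n)"
    by (simp add: squarefree_kernel_def)
  also have "\<dots> = n"
    using assms by (simp add: prime_factorization_nat [symmetric])
  finally show "squarefree_kernel n = n" .
next
  have "squarefree (\<Prod>p\<in>prime_factors n. p)"
    by (rule squarefree_prod_coprime)
      (auto simp: primes_coprime squarefree_prime in_prime_factors_iff)
  then show "squarefree_kernel n = n \<Longrightarrow> squarefree n"
    by (simp add: squarefree_kernel_def)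
qed

text \<open>The Ramanujan sum of modulus \<open>squarefree_kernel n\<close> in closed form, kept
  integer-valued so that zeros and units can be studied over the integers.\<close>

definition kernel_ramanujan_sum :: "nat \<Rightarrow> nat \<Rightarrow> int" where
  "kernel_ramanujan_sum n k = (\<Prod>p\<in>prime_factors n. if p dvd k then int p - 1 else -1)"

lemma kernel_ramanujan_sum_nonzero: "kernel_ramanujan_sum n k \<noteq> 0"
proof -
  have "int p \<noteq> 1" if "p \<in> prime_factors n" for p
    using that by (auto simp: in_prime_factors_iff)
  then show ?thesis by (auto simp: kernel_ramanujan_sum_def)
qed

lemma ramanujan_sum_kernel:
  assumes "n \<ge> 1" "n = squarefree_kernel n * m"
  shows "ramanujan_sum n (int k) =
    (if m dvd k then of_int (int m * kernel_ramanujan_sum n (k div m)) else 0)"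
proof -
  have m: "m \<ge> 1" using assms by (cases m) auto
  have ker: "ramanujan_sum (squarefree_kernel n) (int l) = of_int (kernel_ramanujan_sum n l)" for l
    unfolding squarefree_kernel_def kernel_ramanujan_sum_def
    by (rule ramanujan_sum_prod_primes) auto
  show ?thesis
    using sum_lifted_coprime_residues [OF squarefree_kernel_pos m, of n k] assms
    by (simp add: ramanujan_sum_eq coprime_squarefree_kernel_iff ker)
qed

text \<open>The absolute value is a product of natural numbers, which is 1 only if every factor is;
  a factor \<open>p - 1\<close> is 1 exactly for \<open>p = 2\<close>.\<close>

lemma kernel_ramanujan_sum_unit_iff:
  "\<bar>kernel_ramanujan_sum n k\<bar> = 1 \<longleftrightarrow> (\<forall>p\<in>prime_factors n. p dvd k \<longrightarrow> p = 2)"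
proof -
  have abs: "\<bar>kernel_ramanujan_sum n k\<bar> = int (\<Prod>p\<in>prime_factors n. if p dvd k then p - 1 else 1)"
    unfolding kernel_ramanujan_sum_def abs_prod of_nat_prod
    by (intro prod.cong refl) (auto simp: of_nat_diff Suc_le_eq prime_factors_gt_0_nat)
  have "(if p dvd k then p - 1 else 1) = 1 \<longleftrightarrow> (p dvd k \<longrightarrow> p = 2)" for p by auto
  then show ?thesis
    unfolding abs of_nat_eq_1_iff prod_eq_1_iff [OF finite_set_mset] by (simp only:)
qed

text \<open>For odd \<open>n\<close> the unit condition is coprimality to \<open>n\<close>. For
  \<open>n = 2 * h\<close> the prime 2 imposes no restriction, leaving coprimality to
  \<open>h\<close> over two periods of length \<open>h\<close>.\<close>

lemma card_kernel_ramanujan_sum_unit: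
  assumes "n \<ge> 1" "squarefree n"
  shows "card {k. k < n \<and> \<bar>kernel_ramanujan_sum n k\<bar> = 1} =
    (if odd n then totient n else 2 * totient (n div 2))"
proof -
  have coprime_iff: "coprime k h \<longleftrightarrow> (\<forall>p. prime p \<longrightarrow> p dvd h \<longrightarrow> \<not> p dvd k)" if "h \<ge> 1" for k h :: nat
    using that by (metis coprime_common_divisor coprime_iff_gcd_eq_1 gcd_greatest_iff
        not_prime_unit prime_factor_nat)
  show ?thesis
  proof (cases "odd n")
    case True
    then have "\<bar>kernel_ramanujan_sum n k\<bar> = 1 \<longleftrightarrow> coprime k n" for k
      using assms by (auto simp: kernel_ramanujan_sum_unit_iff coprime_iff in_prime_factors_iff)
    then show ?thesis using True card_lifted_coprime_residues [of n 1] assms by simp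
  next
    case False
    then obtain h where h: "n = 2 * h" by (auto elim: evenE)
    then have h1: "h \<ge> 1" using assms by auto
    have "odd h"
    proof
      assume "even h"
      then have "2 ^ 2 dvd n" using h by (auto elim!: evenE)
      then have "is_unit (2::nat)" using assms(2) by (rule squarefreeD [rotated])
      then show False by simp
    qed
    have "\<bar>kernel_ramanujan_sum n k\<bar> = 1 \<longleftrightarrow> coprime k h" for k
    proof -
      \<comment> \<open>Since \<open>h\<close> is odd, its primes are exactly the odd primes of
        \<open>n\<close>.\<close>
      have "p dvd n \<and> p \<noteq> 2 \<longleftrightarrow> p dvd h" if "prime p" for p
        using that \<open>odd h\<close> h by (auto simp: prime_dvd_mult_iff primes_dvd_imp_eq)
      then show ?thesis
        unfolding kernel_ramanujan_sum_unit_iff coprime_iff [OF h1]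
        using assms by (metis in_prime_factors_iff not_one_le_zero)
    qed
    then show ?thesis
      using False h card_lifted_coprime_residues [of h 2] h1 by (simp add: mult.commute)
  qed
qed

section \<open>Coefficients of the Ramanujan polynomial\<close>

lemma coeff_ramanujan_poly:
  "coeff (ramanujan_poly n) k = (if k < n then ramanujan_sum n (int k) else 0)"
  by (simp add: ramanujan_poly_def coeff_sum)

theorem theorem3:
  fixes n :: nat
  assumes "n \<ge> 1"
  shows "card {k. coeff (ramanujan_poly n) k \<noteq> 0} = squarefree_kernel n
    \<and> degree (ramanujan_poly n) = n - n div squarefree_kernel n
    \<and> ((\<exists>k. coeff (ramanujan_poly n) k \<in> {1, -1}) \<longleftrightarrow> squarefree n)
    \<and> (squarefree n \<longrightarrow>
         card {k. coeff (ramanujan_poly n) k \<in> {1, -1}} =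
           (if odd n then totient n else 2 * totient (n div 2)))"
proof -
  define q where "q = squarefree_kernel n"
  obtain m where n: "n = q * m"
    using squarefree_kernel_dvd [OF assms] by (auto simp: q_def)
  have q: "q \<ge> 1" using squarefree_kernel_pos by (simp add: q_def)
  have m: "m \<ge> 1" using assms n by (cases m) auto
  have coeff: "coeff (ramanujan_poly n) k =
      (if k < n \<and> m dvd k then of_int (int m * kernel_ramanujan_sum n (k div m)) else 0)" for k
    using ramanujan_sum_kernel [OF assms n [unfolded q_def]] by (simp add: coeff_ramanujan_poly)
  have support: "coeff (ramanujan_poly n) k \<noteq> 0 \<longleftrightarrow> k < n \<and> m dvd k" for k
    using m by (simp add: coeff kernel_ramanujan_sum_nonzero)
  \<comment> \<open>The support consists of the multiples of \<open>m\<close> below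
    \<open>q * m\<close>, of which there are \<open>q\<close>.\<close>
  have "{k. coeff (ramanujan_poly n) k \<noteq> 0} = (\<lambda>l. m * l) ` {..<q}"
    using m unfolding support by (auto simp: n mult.commute)
  then have i: "card {k. coeff (ramanujan_poly n) k \<noteq> 0} = q"
    using m by (simp add: card_image inj_on_def)
  have ii: "degree (ramanujan_poly n) = n - m"
  proof (rule antisym)
    show "degree (ramanujan_poly n) \<le> n - m"
    proof (rule degree_le, intro allI impI)
      fix k assume k: "n - m < k"
      have "\<not> (k < n \<and> m dvd k)"
      proof
        assume "k < n \<and> m dvd k"
        then obtain l where "k = m * l" "l < q" using n m by (auto simp: mult.commute)
        \<comment> \<open>From \<open>l + 1 \<le> q\<close>: the largest multiple of
          \<open>m\<close> below \<open>n\<close> is \<open>n - m\<close>.\<close>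
        then have "k + m \<le> n" using n mult_le_mono2 [of "l + 1" q m] by (simp add: mult.commute)
        then show False using k by simp
      qed
      then show "coeff (ramanujan_poly n) k = 0" using support by blast
    qed
    have "n - m < n \<and> m dvd n - m" using n m assms by simp
    then show "n - m \<le> degree (ramanujan_poly n)"
      by (intro le_degree) (simp only: support)
  qed
  have unit: "coeff (ramanujan_poly n) k \<in> {1, -1} \<longleftrightarrow>
      m = 1 \<and> k < n \<and> \<bar>kernel_ramanujan_sum n k\<bar> = 1" for k
  proof -
    have of_int_unit: "(of_int z :: complex) \<in> {1, -1} \<longleftrightarrow> \<bar>z\<bar> = 1" for z
    proof -
      have "(of_int z :: complex) = -1 \<longleftrightarrow> z = -1"
        using of_int_eq_iff [of z "-1", where ?'a = complex] by simp
      then show ?thesis by auto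
    qed
    \<comment> \<open>An integer product is a unit only if both factors are, so any
      \<open>m > 1\<close> excludes coefficients 1 and -1.\<close>
    have "\<bar>int m * kernel_ramanujan_sum n l\<bar> = 1 \<longleftrightarrow> m = 1 \<and> \<bar>kernel_ramanujan_sum n l\<bar> = 1" for l
      by (auto simp: abs_mult zmult_eq_1_iff)
    then show ?thesis
      unfolding coeff using of_int_unit [of "int m * kernel_ramanujan_sum n (k div m)"]
      by (cases "k < n \<and> m dvd k"; cases "m = 1") simp_all
  qed
  have m1: "m = 1 \<longleftrightarrow> squarefree n"
  proof -
    have "q = n \<longleftrightarrow> m = 1" using n q by (metis mult.right_neutral mult_left_cancel not_one_le_zero)
    then show ?thesis using squarefree_iff_squarefree_kernel_eq [OF assms] by (simp add: q_def)
  qed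
  have iv: "card {k. coeff (ramanujan_poly n) k \<in> {1, -1}} =
      (if odd n then totient n else 2 * totient (n div 2))" if "squarefree n"
    using card_kernel_ramanujan_sum_unit [OF assms that] that unfolding unit m1 by simp
  have "\<exists>k. coeff (ramanujan_poly n) k \<in> {1, -1}" if "squarefree n"
  proof -
    have "n div 2 \<ge> 1" if "even n" using that assms by (auto elim!: evenE)
    \<comment> \<open>Existence follows from the count: the totients involved are positive.\<close>
    then have "card {k. coeff (ramanujan_poly n) k \<in> {1, -1}} > 0"
      using iv [OF that] assms by (auto simp: totient_gt_0_iff)
    then have "{k. coeff (ramanujan_poly n) k \<in> {1, -1}} \<noteq> {}"
      by (metis card.empty less_irrefl)
    then show ?thesis by blast
  qed
  then have iii: "(\<exists>k. coeff (ramanujan_poly n) k \<in> {1, -1}) \<longleftrightarrow> squarefree n"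
    using unit m1 by blast
  have "n div q = m" using n q by simp
  then show ?thesis
    using i ii iii iv by (simp add: q_def)
qed

end
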